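(* Suppose $(B,a,b)$ is a Shabat-Blaschke product of degree $n$ and of modulus $\lambda$. Let $l$ be the geodesic between $a$ and $b$ under the Poincaré metric of $\mathbb{D}$. Then the modulus of $\mathbb{D}\setminus B^{-1}(l)$ is $\lambda/n$.
   Context: $\mathbb{D}$ is the open unit disk in $\mathbb{C}$. A Shabat-Blaschke product is a triple $(B,a,b)$ where $a,b$ are two distinct points of $\mathbb{D}$ and $B:\mathbb{D}\to\mathbb{D}$ is a (nonconstant) finite Blaschke product, i.e. $B(z)=c\prod_{i=1}^n\frac{z-z_i}{1-\overline{z_i}z}$ with $n\ge 1$, $|c|=1$, $z_i\in\mathbb{D}$, whose critical values in $\mathbb{D}$ all lie in $\{a,b\}$; its degree is $n$. For $0<r<1$ let $A_r=\{z: r<|z|<1\}$. If a doubly connected domain $U\subset\mathbb{C}$ (one whose complement in the Riemann sphere has exactly two components) is conformally equivalent to $A_r$ with $0<r<1$, its modulus is $M(U)=\frac{1}{2\pi}\log(1/r)$. The modulus of a Shabat-Blaschke product $(B,a,b)$ is $\lambda=M(\mathbb{D}\setminus l)$, where $l$ is the closed geodesic segment joining $a$ and $b$ in the Poincaré metric. The domain $\mathbb{D}\setminus B^{-1}(l)$ is doubly connected. *)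

theory Defs
  imports "HOL-Complex_Analysis.Complex_Analysis"
begin

abbreviation unit_disk :: "complex set" where
  "unit_disk \<equiv> ball 0 1"

definition finite_blaschke_product :: "(complex \<Rightarrow> complex) \<Rightarrow> nat \<Rightarrow> bool" where
  "finite_blaschke_product B n \<longleftrightarrow>
     n \<ge> 1 \<and>
     (\<exists>c \<zeta>. cmod c = 1 \<and> (\<forall>i<n. \<zeta> i \<in> unit_disk) \<and>
       (\<forall>z\<in>unit_disk. B z = c * (\<Prod>i<n. (z - \<zeta> i) / (1 - cnj (\<zeta> i) * z))))"

definition shabat_blaschke_product ::
    "(complex \<Rightarrow> complex) \<Rightarrow> complex \<Rightarrow> complex \<Rightarrow> nat \<Rightarrow> bool" where
  "shabat_blaschke_product B a b n \<longleftrightarrow>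
     a \<in> unit_disk \<and> b \<in> unit_disk \<and> a \<noteq> b \<and>
     finite_blaschke_product B n \<and>
     B ` {z \<in> unit_disk. deriv B z = 0} \<subseteq> {a, b}"

text \<open>
  The Poincare metric is the Riemannian metric \<open>2 |dz| / (1 - |z|\<^sup>2)\<close> on the unit disk.
  The integrand below may be meaningless at the finitely many breakpoints of a
  piecewise \<open>C\<^sup>1\<close> path, which does not affect the integral.
\<close>
definition poincare_length :: "(real \<Rightarrow> complex) \<Rightarrow> real" where
  "poincare_length \<gamma> =
     integral {0..1} (\<lambda>t. 2 * cmod (vector_derivative \<gamma> (at t)) / (1 - (cmod (\<gamma> t))\<^sup>2))"

definition disk_path :: "complex \<Rightarrow> complex \<Rightarrow> (real \<Rightarrow> complex) \<Rightarrow> bool" where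
  "disk_path a b \<gamma> \<longleftrightarrow>
     valid_path \<gamma> \<and> path_image \<gamma> \<subseteq> unit_disk \<and> pathstart \<gamma> = a \<and> pathfinish \<gamma> = b"

text \<open>The closed geodesic segment, as a point set: the trace of a shortest path.\<close>
definition poincare_geodesic_segment :: "complex \<Rightarrow> complex \<Rightarrow> complex set \<Rightarrow> bool" where
  "poincare_geodesic_segment a b l \<longleftrightarrow>
     (\<exists>\<gamma>. disk_path a b \<gamma> \<and>
          (\<forall>\<eta>. disk_path a b \<eta> \<longrightarrow> poincare_length \<gamma> \<le> poincare_length \<eta>) \<and>
          l = path_image \<gamma>)"

text \<open>The Riemann sphere is the one-point compactification of the plane, \<open>None\<close> being infinity.\<close>
definition riemann_sphere :: "complex option topology" where
  "riemann_sphere = Alexandroff_compactification euclidean"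

definition doubly_connected :: "complex set \<Rightarrow> bool" where
  "doubly_connected U \<longleftrightarrow>
     open U \<and> connected U \<and>
     card (connected_components_of (subtopology riemann_sphere (UNIV - Some ` U))) = 2"

definition conformally_equivalent :: "complex set \<Rightarrow> complex set \<Rightarrow> bool" where
  "conformally_equivalent U V \<longleftrightarrow>
     (\<exists>f g. f holomorphic_on U \<and> g holomorphic_on V \<and>
            (\<forall>z\<in>U. f z \<in> V \<and> g (f z) = z) \<and>
            (\<forall>w\<in>V. g w \<in> U \<and> f (g w) = w))"

definition annulus :: "real \<Rightarrow> complex set" where
  "annulus r = {z. r < cmod z \<and> cmod z < 1}"

text \<open>
  A relation rather than a function, because the modulus is defined only for domains that
  are conformally equivalent to some annulus; such an annulus is unique.
\<close>
definition has_modulus :: "complex set \<Rightarrow> real \<Rightarrow> bool" where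
  "has_modulus U m \<longleftrightarrow>
     doubly_connected U \<and>
     (\<exists>r. 0 < r \<and> r < 1 \<and> conformally_equivalent U (annulus r) \<and>
          m = 1 / (2 * pi) * ln (1 / r))"

end

theory Submission
  imports Defs "HOL-Computational_Algebra.Fundamental_Theorem_Algebra"
begin

text \<open>
  Write \<open>U\<close> for the disk minus \<open>l\<close>, \<open>K\<close> for the preimage of \<open>l\<close> and \<open>V\<close> for the disk minus \<open>K\<close>.
  The critical values of \<open>B\<close> are endpoints of \<open>l\<close>, so over \<open>U\<close> the Blaschke product has no
  critical points. Every fibre over \<open>U\<close> then has exactly \<open>n\<close> points, being the zero set of a
  polynomial of degree \<open>n\<close> with simple zeros (\<open>finite_blaschke_fibre_card\<close>), and a local
  homeomorphism with fibres of constant finite size is a covering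
  (\<open>covering_space_constant_fibre_card\<close>). Hence \<open>B\<close> restricts to an \<open>n\<close>-sheeted
  holomorphic covering of \<open>U\<close> by \<open>V\<close>. The set \<open>V\<close> is connected, because every path in \<open>U\<close> that
  runs towards the unit circle lifts to a path ending in one connected collar of the circle.

  A connected \<open>n\<close>-sheeted cover of the annulus \<open>r < |z| < 1\<close> is, up to conformal equivalence,
  the annulus \<open>r\<^bsup>1/n\<^esup> < |z| < 1\<close> covering it by \<open>z \<mapsto> z\<^sup>n\<close>. The proof lifts the
  universal covering \<open>exp\<close> of the annulus to a map from a strip onto \<open>V\<close> and shows that its
  group of periods is generated by \<open>2\<pi>\<i>n\<close> (\<open>finite_annulus_cover_uniformization\<close>). Taking the
  \<open>n\<close>-th root of the inner radius divides the modulus by \<open>n\<close>.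

  It remains to see that \<open>V\<close> is doubly connected, that is, that \<open>K\<close> is connected. This follows
  from the conformal type of \<open>V\<close> just found: an annulus has only two ends, whereas a splitting of \<open>K\<close>
  into two closed pieces would give \<open>V\<close> three (\<open>annulus_not_three_ended\<close>).
\<close>

section \<open>Finite Blaschke products\<close>

lemma blaschke_factor_norm_identity:
  "(cmod (1 - cnj w * z))\<^sup>2 - (cmod (z - w))\<^sup>2 = (1 - (cmod z)\<^sup>2) * (1 - (cmod w)\<^sup>2)"
  unfolding cmod_power2 by (simp add: algebra_simps power2_eq_square)

lemma blaschke_denominator_nonzero:
  assumes "cmod w < 1" "cmod z \<le> 1"
  shows "1 - cnj w * z \<noteq> 0"
proof
  assume "1 - cnj w * z = 0"
  then have "cnj w * z = 1" by simp
  then have "cmod w * cmod z = 1" by (metis norm_mult norm_one complex_mod_cnj)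
  moreover have "cmod w * cmod z \<le> cmod w"
    using assms(2) by (intro mult_left_le) simp_all
  ultimately show False using assms(1) by linarith
qed

lemma blaschke_factor_ge_outside:
  assumes "cmod w < 1" "cmod z \<ge> 1"
  shows "cmod (1 - cnj w * z) \<le> cmod (z - w)"
proof -
  have "(1 - (cmod z)\<^sup>2) * (1 - (cmod w)\<^sup>2) \<le> 0"
  proof (rule mult_nonpos_nonneg)
    show "1 - (cmod z)\<^sup>2 \<le> 0" using assms(2) by (simp add: one_le_power)
    show "0 \<le> 1 - (cmod w)\<^sup>2" using assms(1) by (simp add: power_le_one)
  qed
  then have "(cmod (1 - cnj w * z))\<^sup>2 \<le> (cmod (z - w))\<^sup>2"
    unfolding blaschke_factor_norm_identity[of w z, symmetric] by linarith
  then show ?thesis by (rule power2_le_imp_le) (rule norm_ge_zero)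
qed

lemma finite_blaschke_productE:
  assumes "finite_blaschke_product B n"
  obtains c \<zeta> where "n \<ge> 1" "cmod c = 1" "\<And>i. i < n \<Longrightarrow> cmod (\<zeta> i) < 1"
    "\<And>z. z \<in> unit_disk \<Longrightarrow> B z = c * (\<Prod>i<n. (z - \<zeta> i) / (1 - cnj (\<zeta> i) * z))"
proof -
  obtain c \<zeta> where "n \<ge> 1" "cmod c = 1" "\<forall>i<n. \<zeta> i \<in> unit_disk"
    "\<forall>z\<in>unit_disk. B z = c * (\<Prod>i<n. (z - \<zeta> i) / (1 - cnj (\<zeta> i) * z))"
    using assms unfolding finite_blaschke_product_def by blast
  then show ?thesis by (intro that[of c \<zeta>]) simp_all
qed

lemma finite_blaschke_holomorphic:
  assumes "finite_blaschke_product B n"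
  shows "B holomorphic_on unit_disk"
proof -
  obtain c \<zeta> where B: "\<And>i. i < n \<Longrightarrow> cmod (\<zeta> i) < 1"
    "\<And>z. z \<in> unit_disk \<Longrightarrow> B z = c * (\<Prod>i<n. (z - \<zeta> i) / (1 - cnj (\<zeta> i) * z))"
    by (rule finite_blaschke_productE[OF assms]) blast
  have "(\<lambda>z. c * (\<Prod>i<n. (z - \<zeta> i) / (1 - cnj (\<zeta> i) * z))) holomorphic_on unit_disk"
  proof (intro holomorphic_intros)
    fix i z assume "i \<in> {..<n}" "z \<in> unit_disk"
    then show "1 - cnj (\<zeta> i) * z \<noteq> 0"
      using B(1)[of i] by (intro blaschke_denominator_nonzero) simp_all
  qed
  then show ?thesis by (rule holomorphic_transform) (simp add: B(2))
qed

lemma finite_blaschke_maps_disk: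
  assumes "finite_blaschke_product B n" "z \<in> unit_disk"
  shows "B z \<in> unit_disk"
proof -
  obtain c \<zeta> where B: "n \<ge> 1" "cmod c = 1" "\<And>i. i < n \<Longrightarrow> cmod (\<zeta> i) < 1"
    "\<And>z. z \<in> unit_disk \<Longrightarrow> B z = c * (\<Prod>i<n. (z - \<zeta> i) / (1 - cnj (\<zeta> i) * z))"
    by (rule finite_blaschke_productE[OF assms(1)]) blast
  have factor: "cmod ((z - \<zeta> i) / (1 - cnj (\<zeta> i) * z)) < 1" if "i < n" for i
    using Moebius_function_norm_lt_1[of "\<zeta> i" z 0] B(3)[OF that] assms(2)
    by (simp add: Moebius_function_simple)
  have "cmod (B z) = (\<Prod>i<n. cmod ((z - \<zeta> i) / (1 - cnj (\<zeta> i) * z)))"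
    using B assms(2) by (simp add: norm_mult prod_norm)
  also have "\<dots> < (\<Prod>i<n. 1)"
  proof (rule prod_mono_strict)
    show "0 \<in> {..<n}" using B(1) by simp
    show "cmod ((z - \<zeta> 0) / (1 - cnj (\<zeta> 0) * z)) < 1" using factor[of 0] B(1) by simp
    show "0 \<le> cmod ((z - \<zeta> i) / (1 - cnj (\<zeta> i) * z)) \<and>
        cmod ((z - \<zeta> i) / (1 - cnj (\<zeta> i) * z)) \<le> 1" if "i \<in> {..<n}" for i
      using factor[of i] that by (metis less_imp_le lessThan_iff norm_ge_zero)
  qed simp_all
  finally have "cmod (B z) < 1" by (simp only: prod.neutral_const)
  then show ?thesis by simp
qed

text \<open>
  The defining formula extends continuously to the closed disk and has modulus at least one on
  the unit circle, so the preimage of \<open>l\<close> is also the preimage of \<open>l\<close> in the closed disk.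
\<close>
lemma finite_blaschke_proper:
  assumes B: "finite_blaschke_product B n" and l: "compact l" "l \<subseteq> unit_disk"
  shows "compact {z \<in> unit_disk. B z \<in> l}"
proof -
  obtain c \<zeta> where c: "cmod c = 1" and \<zeta>: "\<And>i. i < n \<Longrightarrow> cmod (\<zeta> i) < 1"
    and B: "\<And>z. z \<in> unit_disk \<Longrightarrow> B z = c * (\<Prod>i<n. (z - \<zeta> i) / (1 - cnj (\<zeta> i) * z))"
    by (rule finite_blaschke_productE[OF B]) blast
  define F where "F z = c * (\<Prod>i<n. (z - \<zeta> i) / (1 - cnj (\<zeta> i) * z))" for z
  have "continuous_on (cball 0 1) F"
    unfolding F_def
  proof (intro continuous_intros ballI)
    fix i z assume "i \<in> {..<n}" "z \<in> cball (0 :: complex) 1"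
    then show "1 - cnj (\<zeta> i) * z \<noteq> 0"
      using \<zeta>[of i] by (intro blaschke_denominator_nonzero) simp_all
  qed
  then have clF: "closed (cball 0 1 \<inter> F -` l)"
    using l(1) by (intro continuous_closed_preimage) (auto simp: compact_imp_closed)
  have outside: "cmod (F z) \<ge> 1" if "cmod z = 1" for z
  proof -
    have "1 \<le> cmod ((z - \<zeta> i) / (1 - cnj (\<zeta> i) * z))" if "i < n" for i
    proof -
      have "cmod (1 - cnj (\<zeta> i) * z) \<le> cmod (z - \<zeta> i)"
        using \<zeta>[OF that] \<open>cmod z = 1\<close> by (intro blaschke_factor_ge_outside) simp_all
      moreover have "1 - cnj (\<zeta> i) * z \<noteq> 0"
        using \<zeta>[OF that] \<open>cmod z = 1\<close> by (intro blaschke_denominator_nonzero) simp_all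
      ultimately show ?thesis by (simp only: norm_divide) (simp add: le_divide_eq_1)
    qed
    then show ?thesis
      unfolding F_def norm_mult c mult_1 prod_norm[symmetric] by (intro prod_ge_1) auto
  qed
  have "{z \<in> unit_disk. B z \<in> l} = cball 0 1 \<inter> F -` l"
  proof (intro equalityI subsetI)
    fix z assume "z \<in> {z \<in> unit_disk. B z \<in> l}"
    then show "z \<in> cball 0 1 \<inter> F -` l" using B[of z] by (simp add: F_def)
  next
    fix z assume z: "z \<in> cball 0 1 \<inter> F -` l"
    then have "cmod (F z) < 1" using l(2) by auto
    then have "cmod z \<noteq> 1" using outside[of z] by linarith
    then have "z \<in> unit_disk" using z by simp
    then show "z \<in> {z \<in> unit_disk. B z \<in> l}" using B[of z] z by (simp add: F_def)
  qed
  then show ?thesis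
    using compact_Int_closed[OF compact_cball clF, of 0 1] by (simp add: Int_assoc[symmetric])
qed

text \<open>
  If some \<open>\<alpha>\<^sub>i\<close> vanishes, the degree drops below \<open>n\<close>; the coefficient at \<open>n\<close> is given by
  the same formula in that case too.
\<close>
lemma coeff_prod_linear:
  fixes \<alpha> :: "nat \<Rightarrow> 'a::idom"
  shows "degree (\<Prod>i<n. [:1, - \<alpha> i:]) \<le> n \<and> coeff (\<Prod>i<n. [:1, - \<alpha> i:]) n = (\<Prod>i<n. - \<alpha> i)"
proof (induction n)
  case (Suc n)
  define Q where "Q = (\<Prod>i<n. [:1, - \<alpha> i:])"
  have Q: "degree Q \<le> n" "coeff Q n = (\<Prod>i<n. - \<alpha> i)"
    using Suc unfolding Q_def by blast+
  have eq: "(\<Prod>i<Suc n. [:1, - \<alpha> i:]) = Q * [:1, - \<alpha> n:]"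
    unfolding Q_def by (rule prod.lessThan_Suc)
  have "degree [:1, - \<alpha> n:] \<le> 1" by simp
  then have "degree (Q * [:1, - \<alpha> n:]) \<le> Suc n"
    using degree_mult_le[of Q "[:1, - \<alpha> n:]"] Q(1) by linarith
  moreover have "coeff Q (Suc n) = 0"
    using Q(1) by (intro coeff_eq_0) linarith
  then have "coeff (Q * [:1, - \<alpha> n:]) (Suc n) = coeff Q n * (- \<alpha> n)"
    by (simp add: mult_pCons_right)
  then have "coeff (Q * [:1, - \<alpha> n:]) (Suc n) = (\<Prod>i<Suc n. - \<alpha> i)"
    by (simp only: Q(2) prod.lessThan_Suc)
  ultimately show ?case unfolding eq by blast
qed simp

text \<open>
  Clearing denominators, \<open>B z = u\<close> becomes \<open>P z - u * Q z = 0\<close> with \<open>P\<close> the numerator and \<open>Q\<close>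
  the denominator of \<open>B\<close>. The difference has degree \<open>n\<close>, because its coefficient at \<open>n\<close> differs
  from \<open>c\<close> by a number of modulus less than one. Outside the open disk \<open>|Q| \<le> |P|\<close>, which
  with \<open>|u| < 1\<close> excludes zeros there, and a point of the fibre is a simple zero when \<open>B\<close> is not critical at it.
\<close>
lemma finite_blaschke_fibre_card:
  assumes B: "finite_blaschke_product B n" and u: "u \<in> unit_disk"
    and regular: "\<And>z. z \<in> unit_disk \<Longrightarrow> B z = u \<Longrightarrow> deriv B z \<noteq> 0"
  shows "card {z \<in> unit_disk. B z = u} = n"
proof -
  obtain c \<zeta> where c: "cmod c = 1" and \<zeta>: "\<And>i. i < n \<Longrightarrow> cmod (\<zeta> i) < 1"
    and Beq: "\<And>z. z \<in> unit_disk \<Longrightarrow> B z = c * (\<Prod>i<n. (z - \<zeta> i) / (1 - cnj (\<zeta> i) * z))"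
    by (rule finite_blaschke_productE[OF B]) blast
  define P where "P = smult c (\<Prod>i<n. [:- \<zeta> i, 1:])"
  define Q where "Q = (\<Prod>i<n. [:1, - cnj (\<zeta> i):])"
  define p where "p = P - smult u Q"
  have polyP: "poly P z = c * (\<Prod>i<n. z - \<zeta> i)" for z
    by (simp add: P_def poly_prod)
  have polyQ: "poly Q z = (\<Prod>i<n. 1 - cnj (\<zeta> i) * z)" for z
    by (simp add: Q_def poly_prod mult.commute)
  have Q0: "poly Q z \<noteq> 0" if "cmod z \<le> 1" for z
  proof -
    have "1 - cnj (\<zeta> i) * z \<noteq> 0" if "i < n" for i
      using \<zeta>[OF that] \<open>cmod z \<le> 1\<close> by (rule blaschke_denominator_nonzero)
    then show ?thesis unfolding polyQ by (subst prod_zero_iff) auto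
  qed
  have p_eq: "poly p z = poly Q z * (B z - u)" if "z \<in> unit_disk" for z
  proof -
    have "B z = poly P z / poly Q z"
      unfolding polyP polyQ Beq[OF that] prod_dividef by simp
    moreover have "poly Q z \<noteq> 0" using Q0 that by simp
    ultimately show ?thesis by (simp add: p_def field_simps)
  qed
  have p_outside: "poly p z \<noteq> 0" if z: "cmod z \<ge> 1" for z
  proof
    assume "poly p z = 0"
    then have eq: "poly P z = u * poly Q z" by (simp add: p_def)
    have "cmod (poly Q z) \<le> cmod (poly P z)"
      unfolding polyP polyQ norm_mult c mult_1 prod_norm[symmetric]
      using \<zeta> z by (intro prod_mono conjI blaschke_factor_ge_outside) auto
    then have "cmod (poly Q z) \<le> cmod u * cmod (poly Q z)"
      using eq by (simp add: norm_mult)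
    moreover have "cmod u < 1" using u by simp
    ultimately have "poly Q z = 0"
      by (metis linorder_not_less mult_le_cancel_right1 norm_le_zero_iff)
    then have "poly P z = 0" using eq by simp
    then obtain i where "i < n" "z = \<zeta> i" using c by (auto simp: polyP)
    then show False using \<zeta> z by force
  qed
  have deg: "degree p = n"
  proof -
    have dP: "degree P = n" "coeff P n = c"
    proof -
      have "degree (\<Prod>i<n. [:- \<zeta> i, 1:]) = n"
        by (subst degree_prod_eq_sum_degree) auto
      moreover have "lead_coeff (\<Prod>i<n. [:- \<zeta> i, 1:]) = 1"
        by (simp add: lead_coeff_prod)
      ultimately show "degree P = n" "coeff P n = c" using c by (auto simp: P_def)
    qed
    have dQ: "degree Q \<le> n" "coeff Q n = (\<Prod>i<n. - cnj (\<zeta> i))"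
      using coeff_prod_linear[where n = n and \<alpha> = "\<lambda>i. cnj (\<zeta> i)"] by (auto simp: Q_def)
    have "cmod (\<Prod>i<n. - cnj (\<zeta> i)) \<le> 1"
      unfolding prod_norm[symmetric] using \<zeta> by (intro prod_le_1) (auto simp: less_imp_le)
    then have "cmod (u * coeff Q n) < 1"
      using u mult_left_le[of "cmod (coeff Q n)" "cmod u"] by (simp add: norm_mult dQ)
    then have "c \<noteq> u * coeff Q n" using c by auto
    then have "coeff p n \<noteq> 0"
      using dP by (simp add: p_def)
    moreover have "degree p \<le> n"
      unfolding p_def using dP(1) dQ(1) degree_smult_le[of u Q] by (intro degree_diff_le) linarith+
    ultimately show ?thesis by (simp add: le_antisym le_degree)
  qed
  have "p \<noteq> 0"
    using p_outside[of 1] by auto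
  have "poly (pderiv p) z \<noteq> 0" if "poly p z = 0" for z
  proof -
    have z: "z \<in> unit_disk" using p_outside[of z] that by force
    then have Bz: "B z = u" using p_eq[OF z] that Q0[of z] by auto
    have "(B has_field_derivative deriv B z) (at z)"
      using finite_blaschke_holomorphic[OF B] z by (simp add: holomorphic_derivI)
    then have "((\<lambda>z. poly Q z * (B z - u)) has_field_derivative poly Q z * deriv B z) (at z)"
      using Bz by (auto intro!: derivative_eq_intros)
    then have "(poly p has_field_derivative poly Q z * deriv B z) (at z)"
      by (rule has_field_derivative_transform_within_open[OF _ open_ball z]) (simp add: p_eq)
    then have "poly (pderiv p) z = poly Q z * deriv B z"
      using poly_DERIV DERIV_unique by blast
    then show ?thesis using regular[OF z Bz] Q0[of z] z by simp
  qed
  then have "rsquarefree p" by (auto simp: rsquarefree_roots)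
  then have "degree (\<Prod>z | poly p z = 0. [:- z, 1:]) = n"
    using complex_poly_decompose_rsquarefree[of p] \<open>p \<noteq> 0\<close> deg
    by (metis degree_smult_eq leading_coeff_0_iff)
  then have "card {z. poly p z = 0} = n"
    by (simp add: degree_prod_eq_sum_degree)
  moreover have "{z. poly p z = 0} = {z \<in> unit_disk. B z = u}"
      proof (intro Collect_cong iffI)
    fix z assume p0: "poly p z = 0"
    then have "z \<in> unit_disk" using p_outside[of z] by force
    then show "z \<in> unit_disk \<and> B z = u" using p_eq[of z] p0 Q0[of z] by simp
  next
    fix z assume "z \<in> unit_disk \<and> B z = u"
    then show "poly p z = 0" using p_eq[of z] by simp
  qed
  ultimately show ?thesis by simp
qed

section \<open>Coverings with finite fibres\<close>

lemma finite_set_separated_balls: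
  fixes F :: "'a::metric_space set"
  assumes "finite F"
  obtains \<delta> where "\<delta> > 0" "\<And>x y. x \<in> F \<Longrightarrow> y \<in> F \<Longrightarrow> x \<noteq> y \<Longrightarrow> ball x \<delta> \<inter> ball y \<delta> = {}"
proof -
  obtain d where d: "\<And>x. d x > 0 \<and> (\<forall>y\<in>F. y \<noteq> x \<longrightarrow> d x \<le> dist x y)"
    using finite_set_avoid[OF assms] by metis
  define e where "e = Min (insert 1 (d ` F))"
  have "e > 0" using assms d by (simp add: e_def)
  have "e \<le> dist x y" if "x \<in> F" "y \<in> F" "x \<noteq> y" for x y
  proof -
    have "e \<le> d x" using assms that by (simp add: e_def)
    then show ?thesis using d that by force
  qed
  then have e: "\<And>x y. x \<in> F \<Longrightarrow> y \<in> F \<Longrightarrow> dist x y < e \<Longrightarrow> x = y"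
    by (meson not_less)
  show ?thesis
  proof (rule that[of "e / 2"])
    fix x y assume "x \<in> F" "y \<in> F" "x \<noteq> y"
    then show "ball x (e / 2) \<inter> ball y (e / 2) = {}"
      using e[of x y] dist_triangle_half_r[of _ x e y] by (fastforce simp: dist_commute)
  qed (use \<open>e > 0\<close> in auto)
qed

text \<open>
  Disjoint neighbourhoods of the \<open>n\<close> points over \<open>x\<close>, each mapped injectively, already supply \<open>n\<close>
  points over every \<open>u\<close> near \<open>x\<close>. As there are no others, these neighbourhoods contain
  the whole fibre over \<open>u\<close>, and they evenly cover. Counting thus replaces the usual
  properness argument.
\<close>
lemma covering_space_constant_fibre_card:
  fixes p :: "complex \<Rightarrow> complex"
  assumes "open V" and hol: "p holomorphic_on V" and im: "p ` V \<subseteq> S"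
    and regular: "\<And>z. z \<in> V \<Longrightarrow> deriv p z \<noteq> 0"
    and fibre: "\<And>u. u \<in> S \<Longrightarrow> card {z \<in> V. p z = u} = n" and "n \<ge> 1"
  shows "covering_space V p S"
  unfolding covering_space_def
proof (intro conjI ballI)
  show "continuous_on V p" using hol by (rule holomorphic_on_imp_continuous_on)
  show "p ` V = S"
  proof (intro equalityI im subsetI)
    fix u assume "u \<in> S"
    then have "{z \<in> V. p z = u} \<noteq> {}" using fibre \<open>n \<ge> 1\<close> by fastforce
    then show "u \<in> p ` V" by blast
  qed
  fix x assume "x \<in> S"
  define F where "F = {z \<in> V. p z = x}"
  have F: "card F = n" using fibre[OF \<open>x \<in> S\<close>] by (simp add: F_def)
  have finF: "finite F" "F \<noteq> {}" using F \<open>n \<ge> 1\<close> by (auto intro: card_ge_0_finite)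
  obtain \<delta> where \<delta>: "\<delta> > 0" "\<And>y z. y \<in> F \<Longrightarrow> z \<in> F \<Longrightarrow> y \<noteq> z \<Longrightarrow> ball y \<delta> \<inter> ball z \<delta> = {}"
    using finite_set_separated_balls[OF finF(1)] by metis
  have "\<exists>r>0. ball z r \<subseteq> V \<and> inj_on p (ball z r)" if "z \<in> F" for z
    using that has_complex_derivative_locally_injective[OF hol _ \<open>open V\<close>] regular
    by (metis (mono_tags, lifting) F_def mem_Collect_eq)
  then obtain r where r: "\<And>z. z \<in> F \<Longrightarrow> r z > 0 \<and> ball z (r z) \<subseteq> V \<and> inj_on p (ball z (r z))"
    by metis
  define W where "W z = ball z (min (r z) \<delta>)" for z
  have W: "z \<in> W z" "open (W z)" "W z \<subseteq> V" "inj_on p (W z)" if "z \<in> F" for z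
    using r[OF that] \<delta>(1) by (auto simp: W_def intro: inj_on_subset)
  have Wdisj: "W y \<inter> W z = {}" if "y \<in> F" "z \<in> F" "y \<noteq> z" for y z
    using \<delta>(2)[OF that] by (auto simp: W_def)
  have openpW: "open (p ` W z)" if "z \<in> F" for z
    using W[OF that] hol by (meson holomorphic_on_subset open_mapping_thm3)
  define T where "T = (\<Inter>z\<in>F. p ` W z)"
  have "open T" unfolding T_def using finF(1) openpW by blast
  have "x \<in> T" using W by (force simp: T_def F_def)
  have "T \<subseteq> S" using finF(2) W(3) im by (fastforce simp: T_def)
  define v where "v = (\<lambda>z. W z \<inter> p -` T) ` F"
  have "\<Union>v = V \<inter> p -` T"
  proof (intro equalityI subsetI)
    fix y assume y: "y \<in> V \<inter> p -` T"
    then have "\<exists>w. w \<in> W z \<and> p w = p y" if "z \<in> F" for z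
      using that by (force simp: T_def)
    then obtain w where w: "\<And>z. z \<in> F \<Longrightarrow> w z \<in> W z \<and> p (w z) = p y" by metis
    have "inj_on w F"
      using w Wdisj by (intro inj_onI) (metis disjoint_iff)
    then have "card (w ` F) = card {z \<in> V. p z = p y}"
      using fibre[of "p y"] y \<open>T \<subseteq> S\<close> F by (auto simp: card_image)
    moreover have "w ` F \<subseteq> {z \<in> V. p z = p y}" using w W(3) by blast
    moreover have "finite {z \<in> V. p z = p y}"
      using fibre[of "p y"] y \<open>T \<subseteq> S\<close> \<open>n \<ge> 1\<close> by (intro card_ge_0_finite) auto
    ultimately have "w ` F = {z \<in> V. p z = p y}" by (metis card_subset_eq)
    then have "y \<in> w ` F" using y by blast
    then show "y \<in> \<Union>v" using w y by (auto simp: v_def)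
  qed (use W(3) in \<open>auto simp: v_def\<close>)
  moreover have "openin (top_of_set V) u" if u: "u \<in> v" for u
  proof -
    obtain z where z: "z \<in> F" "u = W z \<inter> p -` T" using u unfolding v_def by blast
    have "continuous_on (W z) p"
      using hol W(3)[OF z(1)] by (meson continuous_on_subset holomorphic_on_imp_continuous_on)
    then have "open (W z \<inter> p -` T)"
      using W(2)[OF z(1)] \<open>open T\<close> by (rule continuous_open_preimage)
    then show ?thesis
      using z W(3)[OF z(1)] by (intro open_subset) auto
  qed
  moreover have "pairwise disjnt v"
    using Wdisj by (fastforce simp: pairwise_def v_def disjnt_def)
  moreover have "\<exists>q. homeomorphism u T p q" if u: "u \<in> v" for u
  proof -
    obtain z where z: "z \<in> F" "u = W z \<inter> p -` T" using u unfolding v_def by blast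
    obtain q where q: "q holomorphic_on p ` W z" "\<And>y. y \<in> W z \<Longrightarrow> q (p y) = y"
      using holomorphic_has_inverse[of p "W z"] W[OF z(1)] hol holomorphic_on_subset by metis
    have "T \<subseteq> p ` W z" using z by (auto simp: T_def)
    have "homeomorphism u T p q"
    proof (rule homeomorphismI)
      show "continuous_on u p"
        using hol W(3)[OF z(1)] z
        by (auto intro: continuous_on_subset holomorphic_on_imp_continuous_on)
      show "continuous_on T q"
        using q(1) \<open>T \<subseteq> p ` W z\<close> by (meson continuous_on_subset holomorphic_on_imp_continuous_on)
    qed (use z q \<open>T \<subseteq> p ` W z\<close> in force)+
    then show ?thesis by blast
  qed
  moreover have "openin (top_of_set S) T"
    using \<open>open T\<close> \<open>T \<subseteq> S\<close> by (rule open_subset[rotated])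
  ultimately have "x \<in> T \<and> openin (top_of_set S) T \<and> (\<Union>v = V \<inter> p -` T \<and>
      (\<forall>u\<in>v. openin (top_of_set V) u) \<and> pairwise disjnt v \<and> (\<forall>u\<in>v. \<exists>q. homeomorphism u T p q))"
    using \<open>x \<in> T\<close> by (intro conjI ballI) assumption+
  then show "\<exists>T. x \<in> T \<and> openin (top_of_set S) T \<and> (\<exists>v. \<Union>v = V \<inter> p -` T \<and>
      (\<forall>u\<in>v. openin (top_of_set V) u) \<and> pairwise disjnt v \<and> (\<forall>u\<in>v. \<exists>q. homeomorphism u T p q))"
    by (iprover intro: exI)
qed

lemma compact_in_unit_disk_bound:
  assumes "compact K" "K \<subseteq> unit_disk"
  obtains R where "0 \<le> R" "R < 1" "\<And>z. z \<in> K \<Longrightarrow> cmod z \<le> R"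
proof (cases "K = {}")
  case True
  then show ?thesis using that[of 0] by auto
next
  case False
  obtain x where x: "x \<in> K" "\<And>z. z \<in> K \<Longrightarrow> cmod z \<le> cmod x"
    using continuous_attains_sup[OF \<open>compact K\<close> False, of cmod] by (auto intro: continuous_intros)
  show ?thesis
  proof (rule that[of "cmod x"])
    show "cmod x < 1" using x(1) assms(2) by auto
  qed (use x in auto)
qed

text \<open>
  The preimage of \<open>l\<close> is compact, so the cover contains a collar \<open>R < |z| < 1\<close> of the circle. All
  points where \<open>|B|\<close> exceeds its maximum on \<open>|z| \<le> R\<close> lie in that collar, and every point of the cover is
  joined to one of them by lifting a path of the base.
\<close>
lemma path_connected_vimage_by_boundary_collar:
  assumes contB: "continuous_on unit_disk B" and mapsB: "B ` unit_disk \<subseteq> unit_disk"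
    and l: "compact l" "l \<subseteq> unit_disk" and K: "compact {z \<in> unit_disk. B z \<in> l}"
    and cov: "covering_space (unit_disk - {z \<in> unit_disk. B z \<in> l}) B (unit_disk - l)"
    and U: "path_connected (unit_disk - l)"
  shows "path_connected (unit_disk - {z \<in> unit_disk. B z \<in> l})"
proof -
  define V where "V = unit_disk - {z \<in> unit_disk. B z \<in> l}"
  have "{z \<in> unit_disk. B z \<in> l} \<subseteq> unit_disk" by blast
  then obtain R where R0: "0 \<le> R" "R < 1" "\<And>z. z \<in> {z \<in> unit_disk. B z \<in> l} \<Longrightarrow> cmod z \<le> R"
    using compact_in_unit_disk_bound[OF K] by metis
  then have R: "0 \<le> R" "R < 1" "\<And>z. z \<in> unit_disk \<Longrightarrow> B z \<in> l \<Longrightarrow> cmod z \<le> R"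
    by simp_all
  have cball: "cball 0 R \<subseteq> unit_disk" using R by auto
  have "compact (B ` cball 0 R)"
    using contB cball by (intro compact_continuous_image) (auto intro: continuous_on_subset)
  then have "compact (B ` cball 0 R \<union> l)" "B ` cball 0 R \<union> l \<subseteq> unit_disk"
    using l cball mapsB by (auto simp: compact_Un)
  then obtain M where M: "0 \<le> M" "M < 1" "\<And>w. w \<in> B ` cball 0 R \<union> l \<Longrightarrow> cmod w \<le> M"
    by (rule compact_in_unit_disk_bound) blast
  \<comment> \<open>A point of the base whose preimages all lie in the collar.\<close>
  define w where "w = complex_of_real ((M + 1) / 2)"
  have "cmod w = (M + 1) / 2" unfolding w_def norm_of_real using M by simp
  then have w: "cmod w < 1" "M < cmod w" using M by auto
  then have "w \<in> unit_disk - l" using M(3)[of w] by force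
  define C where "C = {z::complex. R < cmod z \<and> cmod z < 1}"
  have "path_connected C"
    using path_connected_annulus(1)[of R "0::complex" 1] by (simp add: C_def)
  have CV: "C \<subseteq> V" using R(3) by (force simp: C_def V_def)
  have to_collar: "\<exists>y\<in>C. path_component V z y" if z: "z \<in> V" for z
  proof -
    have "B z \<in> unit_disk - l"
      using z mapsB unfolding V_def by blast
    then obtain g where g: "path g" "path_image g \<subseteq> unit_disk - l" "pathstart g = B z" "pathfinish g = w"
      using U \<open>w \<in> unit_disk - l\<close> unfolding path_connected_def by metis
    obtain h where h: "path h" "path_image h \<subseteq> V" "pathstart h = z" "\<And>t. t \<in> {0..1} \<Longrightarrow> B (h t) = g t"
      using covering_space_lift_path_strong[OF cov[folded V_def] z g(1-3)] by metis
    have "pathfinish h \<in> V" using h(2) by (meson pathfinish_in_path_image subsetD)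
    then have "pathfinish h \<in> unit_disk" by (simp add: V_def)
    moreover have "B (pathfinish h) = w" using h(4)[of 1] g(4) by (simp add: pathfinish_def)
    then have "\<not> cmod (pathfinish h) \<le> R" using w(2) M(3)[of w] by force
    ultimately have "pathfinish h \<in> C" by (simp add: C_def)
    then show ?thesis using h by (auto simp: path_component_def)
  qed
  have "path_component V y z" if "y \<in> V" "z \<in> V" for y z
  proof -
    obtain y' z' where yz: "y' \<in> C" "z' \<in> C" "path_component V y y'" "path_component V z z'"
      using to_collar \<open>y \<in> V\<close> \<open>z \<in> V\<close> by metis
    have "path_component C y' z'"
      using \<open>path_connected C\<close> yz by (simp add: path_connected_component)
    then have "path_component V y' z'"
      using CV by (rule path_component_of_subset[rotated])
    then show ?thesis
      using yz by (meson path_component_sym path_component_trans)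
  qed
  then show ?thesis unfolding V_def[symmetric] path_connected_component by blast
qed

section \<open>Finite covers of a round annulus\<close>

text \<open>
  The integers act on \<open>F\<close> by shifting the argument of \<open>f\<close>, and the action is transitive. The stabilizer
  of a point is then a subgroup of index \<open>n\<close>, and \<open>n\<int>\<close> is the only such subgroup. In the covering
  argument below, \<open>F\<close> is a fibre and the shift is the monodromy around the annulus.
\<close>
lemma transitive_int_orbit_period:
  fixes f :: "int \<Rightarrow> 'a"
  assumes orbit: "range f = F" and card: "card F = n" and "n \<ge> 1"
    and shift: "\<And>i j k. f j = f k \<Longrightarrow> f (j + i) = f (k + i)"
  shows "f j = f k \<longleftrightarrow> int n dvd j - k"
proof -
  have "finite F"
    using card \<open>n \<ge> 1\<close> by (metis card.infinite not_one_le_zero)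
  \<comment> \<open>Some positive shift returns to the starting point; \<open>d\<close> is the least one.\<close>
  then have "\<not> inj f"
    using orbit finite_imageD infinite_UNIV_int by blast
  then obtain j0 k0 where "f j0 = f k0" "k0 < j0"
    by (metis injI linorder_neqE)
  then have "f (j0 - k0) = f 0" "j0 - k0 > 0"
    using shift[of j0 k0 "- k0"] by simp_all
  then have ex: "\<exists>d::nat. d > 0 \<and> f (int d) = f 0"
    by (intro exI[of _ "nat (j0 - k0)"]) auto
  define d where "d = (LEAST d::nat. d > 0 \<and> f (int d) = f 0)"
  have d: "d > 0" "f (int d) = f 0"
    using LeastI_ex[OF ex] by (simp_all add: d_def)
  have least: "d \<le> e" if "e > 0" "f (int e) = f 0" for e
    using that unfolding d_def by (intro Least_le) auto
  have periodic: "f (i + int d * q) = f i" for i q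
  proof (induction q arbitrary: i rule: int_induct[where k = 0])
    case (step1 q)
    have "f (int d + (i + int d * q)) = f (0 + (i + int d * q))"
      by (rule shift) (rule d)
    then show ?case using step1 by (simp add: algebra_simps)
  next
    case (step2 q)
    have "f (int d + (i + int d * (q - 1))) = f (0 + (i + int d * (q - 1)))"
      by (rule shift) (rule d)
    then show ?case using step2 by (simp add: algebra_simps)
  qed simp
  have mod_d: "f (i mod int d) = f i" for i
    using periodic[of "i mod int d" "i div int d"] by (simp add: mult.commute)
  have iff_d: "f j = f k \<longleftrightarrow> int d dvd j - k" for j k
  proof
    assume "f j = f k"
    then have "f ((j - k) mod int d) = f 0"
      using shift[of j k "- k"] mod_d[of "j - k"] by simp
    moreover have "0 \<le> (j - k) mod int d" "(j - k) mod int d < int d"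
      using d by simp_all
    ultimately have "(j - k) mod int d = 0"
      using least[of "nat ((j - k) mod int d)"] by force
    then show "int d dvd j - k" by presburger
  next
    assume "int d dvd j - k"
    then obtain q where "j = k + int d * q" by (metis dvdE diff_add_cancel add.commute)
    then show "f j = f k" using periodic by simp
  qed
  have "inj_on f {0..<int d}"
  proof (rule inj_onI)
    fix x y assume "x \<in> {0..<int d}" "y \<in> {0..<int d}" "f x = f y"
    then show "x = y"
      using iff_d[of x y] by (simp add: mod_eq_dvd_iff[symmetric])
  qed
  moreover have "f ` {0..<int d} = F"
  proof -
    have "f x \<in> f ` {0..<int d}" for x
      using mod_d[of x] d by (metis atLeastLessThan_iff image_eqI of_nat_0_less_iff
          pos_mod_bound pos_mod_sign)
    then show ?thesis using orbit by auto
  qed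
  ultimately have "d = n"
    using card card_image[of f "{0..<int d}"] by simp
  then show ?thesis using iff_d by simp
qed

lemma strip_exp_annulus:
  assumes "0 < r"
  shows "exp s \<in> annulus r \<longleftrightarrow> ln r < Re s \<and> Re s < 0"
  using assms by (simp add: annulus_def norm_exp_eq_Re) (metis exp_less_cancel_iff exp_ln)

text \<open>
  The map \<open>G\<close> lifts \<open>\<psi> \<circ> exp\<close> through \<open>p\<close>, where \<open>\<psi>\<close> maps the annulus conformally
  to \<open>U\<close>; the strip \<open>S\<close> is simply connected. It is onto because \<open>V\<close> is path connected:
  a path in \<open>V\<close> descends to the annulus, lifts to \<open>S\<close> along \<open>exp\<close>, and \<open>G\<close> returns the original path by
  uniqueness of lifts. Two translates of \<open>G\<close> by multiples of \<open>2\<pi>\<i>\<close> that agree somewhere agree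
  everywhere, so these translations act transitively on each fibre as in the preceding lemma, and the
  periods of \<open>G\<close> are the multiples of \<open>2\<pi>\<i>n\<close>.
\<close>
lemma finite_annulus_cover_uniformization:
  fixes p :: "complex \<Rightarrow> complex" and r :: real
  defines "S \<equiv> {s. ln r < Re s \<and> Re s < 0}"
  assumes r: "0 < r" "r < 1"
    and V: "open V" "path_connected V" and hol: "p holomorphic_on V"
    and cov: "covering_space V p U"
    and fibre: "\<And>u. u \<in> U \<Longrightarrow> card {z \<in> V. p z = u} = n" and n: "n \<ge> 1"
    and equiv: "conformally_equivalent U (annulus r)"
  obtains G where "G holomorphic_on S" "G ` S = V"
    "\<And>s t. s \<in> S \<Longrightarrow> t \<in> S \<Longrightarrow> G s = G t \<longleftrightarrow> exp (s / of_nat n) = exp (t / of_nat n)"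
proof -
  obtain \<phi> \<psi> where hol\<phi>: "\<phi> holomorphic_on U" and hol\<psi>: "\<psi> holomorphic_on annulus r"
    and \<phi>: "\<And>z. z \<in> U \<Longrightarrow> \<phi> z \<in> annulus r \<and> \<psi> (\<phi> z) = z"
    and \<psi>: "\<And>w. w \<in> annulus r \<Longrightarrow> \<psi> w \<in> U \<and> \<phi> (\<psi> w) = w"
    using equiv unfolding conformally_equivalent_def by metis
  have expS: "exp s \<in> annulus r \<longleftrightarrow> s \<in> S" for s
    using strip_exp_annulus[OF r(1)] by (simp add: S_def)
  have S_eq: "S = {s. ln r < Re s} \<inter> {s. Re s < 0}" by (auto simp: S_def)
  have S: "open S" "convex S"
    unfolding S_eq
    by (auto intro!: open_Int convex_Int open_halfspace_Re_gt open_halfspace_Re_lt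
        convex_halfspace_Re_gt convex_halfspace_Re_lt)
  define E where "E s = \<psi> (exp s)" for s
  have EU: "E \<in> S \<rightarrow> U" using \<psi> expS by (auto simp: E_def)
  have holE: "E holomorphic_on S"
  proof -
    have "\<psi> \<circ> exp holomorphic_on S"
      by (rule holomorphic_on_compose_gen[OF holomorphic_on_exp hol\<psi>]) (use expS in auto)
    then show ?thesis by (simp add: E_def[abs_def] o_def)
  qed
  then have contE: "continuous_on S E" by (rule holomorphic_on_imp_continuous_on)
  have E_eq: "E s = E t \<longleftrightarrow> (\<exists>k::int. s = t + of_int k * (2 * of_real pi * \<i>))"
    if "s \<in> S" "t \<in> S" for s t
  proof -
    have "E s = E t \<longleftrightarrow> exp s = exp t"
      using \<psi> expS that by (metis E_def)
    also have "\<dots> \<longleftrightarrow> (\<exists>k::int. s = t + of_int k * (2 * of_real pi * \<i>))"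
      unfolding exp_eq by (simp add: algebra_simps)
    finally show ?thesis .
  qed
  define s0 where "s0 = complex_of_real (ln r / 2)"
  have "ln r < 0" using r by simp
  then have s0: "s0 \<in> S" by (simp add: S_def s0_def)
  then obtain v0 where v0: "v0 \<in> V" "E s0 = p v0"
    using cov EU by (metis Pi_mem covering_space_imp_surjective imageE)
  obtain G where G: "continuous_on S G" "G \<in> S \<rightarrow> V" "G s0 = v0" "\<And>s. s \<in> S \<Longrightarrow> p (G s) = E s"
    by (rule covering_space_lift_strong[OF cov v0(1) s0 _ _ contE EU v0(2)])
      (use S in \<open>auto intro: convex_imp_simply_connected convex_imp_locally_path_connected\<close>)
  have holG: "G holomorphic_on S"
    by (rule covering_space_lift_is_holomorphic[OF cov V(1) hol holE EU G(2) G(1) G(4)])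
  define \<tau> where "\<tau> k s = s + of_int k * (2 * of_real pi * \<i>)" for k :: int and s
  have \<tau>S: "\<tau> k s \<in> S \<longleftrightarrow> s \<in> S" for k s by (simp add: \<tau>_def S_def)
  have \<tau>\<tau>: "\<tau> j (\<tau> k s) = \<tau> (j + k) s" for j k s by (simp add: \<tau>_def algebra_simps)
  have E\<tau>: "E (\<tau> k s) = E s" if "s \<in> S" for k s
    using E_eq[of "\<tau> k s" s] that \<tau>S by (auto simp: \<tau>_def)
  have translates_agree: "G (\<tau> j t) = G (\<tau> k t)" if "G (\<tau> j s) = G (\<tau> k s)" "s \<in> S" "t \<in> S" for j k s t
  proof -
    have lift: "continuous_on S (\<lambda>t. G (\<tau> i t))" "(\<lambda>t. G (\<tau> i t)) \<in> S \<rightarrow> V"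
      "\<And>t. t \<in> S \<Longrightarrow> E t = p (G (\<tau> i t))" for i
    proof -
      have "continuous_on S (\<tau> i)" unfolding \<tau>_def by (intro continuous_intros)
      then show "continuous_on S (\<lambda>t. G (\<tau> i t))"
        by (rule continuous_on_compose2[OF G(1)]) (auto simp: \<tau>S)
      show "(\<lambda>t. G (\<tau> i t)) \<in> S \<rightarrow> V" using G(2) \<tau>S by auto
      show "E t = p (G (\<tau> i t))" if "t \<in> S" for t
        using that G(4)[of "\<tau> i t"] by (simp add: \<tau>S E\<tau>)
    qed
    show ?thesis
      by (rule covering_space_lift_unique[OF cov that(1) contE EU lift(1-3) lift(1-3)
            convex_connected[OF S(2)] that(2,3)])
  qed
  have surj: "\<exists>s\<in>S. G s = v" if v: "v \<in> V" for v
  proof -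
    obtain \<gamma> where \<gamma>: "path \<gamma>" "path_image \<gamma> \<subseteq> V" "pathstart \<gamma> = v0" "pathfinish \<gamma> = v"
      using V(2) v v0(1) unfolding path_connected_def by metis
    have \<gamma>V: "\<gamma> t \<in> V" if "t \<in> {0..1}" for t
      using \<gamma>(2) that by (auto simp: path_image_def)
    have p\<gamma>: "p (\<gamma> t) \<in> U" if "t \<in> {0..1}" for t
      using cov \<gamma>V[OF that] by (metis covering_space_imp_surjective imageI)
    have contp\<gamma>: "continuous_on {0..1} (\<lambda>t. p (\<gamma> t))"
      using \<gamma>(1) \<gamma>V holomorphic_on_imp_continuous_on[OF hol] unfolding path_def
      by (auto intro: continuous_on_compose2)
    have "continuous_on {0..1} (\<lambda>t. \<phi> (p (\<gamma> t)))"
      by (rule continuous_on_compose2[OF holomorphic_on_imp_continuous_on[OF hol\<phi>] contp\<gamma>])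
        (use p\<gamma> in auto)
    then have pq: "path (\<lambda>t. \<phi> (p (\<gamma> t)))" by (simp add: path_def)
    have imq: "path_image (\<lambda>t. \<phi> (p (\<gamma> t))) \<subseteq> - {0}"
      using p\<gamma> \<phi> r unfolding path_image_def annulus_def by fastforce
    have "pathstart (\<lambda>t. \<phi> (p (\<gamma> t))) = \<phi> (p v0)"
      using \<gamma>(3) by (simp add: pathstart_def)
    also have "\<dots> = exp s0"
      using \<psi>[of "exp s0"] expS s0 by (simp add: v0(2)[symmetric] E_def)
    finally obtain h where h: "path h" "pathstart h = s0" "\<And>t. t \<in> {0..1} \<Longrightarrow> exp (h t) = \<phi> (p (\<gamma> t))"
      using covering_space_lift_path_strong[OF covering_space_exp_punctured_plane UNIV_I pq imq]
      by metis
    have hS: "h t \<in> S" if "t \<in> {0..1}" for t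
      using h(3)[OF that] \<phi>[OF p\<gamma>[OF that]] expS by metis
    have "G (h 1) = \<gamma> 1"
    proof (rule covering_space_lift_unique[OF cov _ contp\<gamma>, where a = 0 and ?g1.0 = "\<lambda>t. G (h t)" and ?g2.0 = \<gamma>])
      show "G (h 0) = \<gamma> 0" using h(2) G(3) \<gamma>(3) by (simp add: pathstart_def)
      show "(\<lambda>t. p (\<gamma> t)) \<in> {0..1} \<rightarrow> U" using p\<gamma> by auto
      show "continuous_on {0..1} (\<lambda>t. G (h t))"
        using h(1) hS unfolding path_def by (intro continuous_on_compose2[OF G(1)]) auto
      show "(\<lambda>t. G (h t)) \<in> {0..1} \<rightarrow> V" using G(2) hS by auto
      show "p (\<gamma> t) = p (G (h t))" if "t \<in> {0..1}" for t
        using that G(4) hS h(3) p\<gamma> \<phi> by (simp add: E_def)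
      show "\<gamma> \<in> {0..1} \<rightarrow> V" using \<gamma>V by auto
    qed (use \<gamma>(1) in \<open>auto simp: path_def\<close>)
    then show ?thesis
      using hS[of 1] \<gamma>(4) by (auto simp: pathfinish_def)
  qed
  have period: "G (\<tau> j s) = G (\<tau> k s) \<longleftrightarrow> int n dvd j - k" if s: "s \<in> S" for j k s
  proof (rule transitive_int_orbit_period[where f = "\<lambda>k. G (\<tau> k s)" and F = "{z \<in> V. p z = E s}"])
    show "range (\<lambda>k. G (\<tau> k s)) = {z \<in> V. p z = E s}"
    proof (intro equalityI subsetI)
      fix z assume "z \<in> range (\<lambda>k. G (\<tau> k s))"
      then show "z \<in> {z \<in> V. p z = E s}"
        using G(2,4) \<tau>S E\<tau> s by fastforce
    next
      fix z assume z: "z \<in> {z \<in> V. p z = E s}"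
      then obtain t where t: "t \<in> S" "G t = z" using surj by blast
      then have "E t = E s" using z G(4) by auto
      then obtain k where "t = \<tau> k s" using E_eq[OF t(1) s] by (auto simp: \<tau>_def)
      then show "z \<in> range (\<lambda>k. G (\<tau> k s))" using t by auto
    qed
    show "card {z \<in> V. p z = E s} = n" using fibre EU s by auto
    show "G (\<tau> (j + i) s) = G (\<tau> (k + i) s)" if "G (\<tau> j s) = G (\<tau> k s)" for i j k
      using translates_agree[OF that s, of "\<tau> i s"] s by (simp add: \<tau>\<tau> \<tau>S)
  qed (rule n)
  have "G s = G t \<longleftrightarrow> exp (s / of_nat n) = exp (t / of_nat n)" if st: "s \<in> S" "t \<in> S" for s t
  proof
    assume eq: "G s = G t"
    then have "E s = E t" using G(4) st by metis
    then obtain k where k: "s = \<tau> k t" using E_eq[OF st] by (auto simp: \<tau>_def)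
    then have "G (\<tau> k t) = G (\<tau> 0 t)" using eq by (simp add: \<tau>_def)
    then obtain m where "k = int n * m" using period[OF st(2), of k 0] by auto
    then have "s / of_nat n = t / of_nat n + (of_int (2 * m) * pi) * \<i>"
      using n k by (simp add: \<tau>_def field_simps)
    then show "exp (s / of_nat n) = exp (t / of_nat n)" unfolding exp_eq by blast
  next
    assume "exp (s / of_nat n) = exp (t / of_nat n)"
    then obtain m :: int where "s / of_nat n = t / of_nat n + (of_int (2 * m) * pi) * \<i>"
      unfolding exp_eq by blast
    then have "s = \<tau> (int n * m) t" using n by (simp add: \<tau>_def field_simps)
    moreover have "G (\<tau> (int n * m) t) = G (\<tau> 0 t)"
      using period[OF st(2), of "int n * m" 0] by simp
    ultimately show "G s = G t" by (simp add: \<tau>_def)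
  qed
  moreover have "G ` S = V" using G(2) surj by (auto simp: image_iff)
  ultimately show ?thesis using that holG by blast
qed

text \<open>
  The map \<open>G\<close> factors through \<open>s \<mapsto> exp (s / n)\<close>, which sends the strip onto the annulus of
  inner radius \<open>r\<^bsup>1/n\<^esup>\<close>; the induced map is the conformal equivalence.
\<close>
lemma finite_cover_of_annulus_conformally_equivalent:
  assumes r: "0 < r" "r < 1"
    and V: "open V" "path_connected V" and hol: "p holomorphic_on V"
    and cov: "covering_space V p U"
    and fibre: "\<And>u. u \<in> U \<Longrightarrow> card {z \<in> V. p z = u} = n" and n: "n \<ge> 1"
    and equiv: "conformally_equivalent U (annulus r)"
  shows "conformally_equivalent V (annulus (root n r))"
proof -
  define S where "S = {s. ln r < Re s \<and> Re s < 0}"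
  obtain G where G: "G holomorphic_on S" "G ` S = V"
    and Geq: "\<And>s t. s \<in> S \<Longrightarrow> t \<in> S \<Longrightarrow> G s = G t \<longleftrightarrow> exp (s / of_nat n) = exp (t / of_nat n)"
    using finite_annulus_cover_uniformization[OF assms, folded S_def] by metis
  define A where "A = annulus (root n r)"
  have root0: "0 < root n r" using r n by simp
  have "open A"
  proof -
    have "A = ball 0 1 - cball 0 (root n r)" by (auto simp: A_def annulus_def)
    then show ?thesis by (simp add: open_Diff)
  qed
  have expA: "s \<in> S \<longleftrightarrow> exp (s / of_nat n) \<in> A" for s
  proof -
    have "ln (root n r) = ln r / real n" using r n by (simp add: ln_root)
    then show ?thesis
      unfolding A_def strip_exp_annulus[OF root0] S_def using n by (simp add: divide_less_cancel divide_less_0_iff)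
  qed
  define g where "g w = G (of_nat n * Ln w)" for w
  have LnS: "of_nat n * Ln w \<in> S" if "w \<in> A" for w
  proof -
    have "w \<noteq> 0" using that root0 by (auto simp: A_def annulus_def)
    then have "exp (of_nat n * Ln w / of_nat n) = w" using n by simp
    then show ?thesis using expA[of "of_nat n * Ln w"] that by metis
  qed
  have g_exp: "g (exp (s / of_nat n)) = G s" if "s \<in> S" for s
    unfolding g_def using that n expA LnS by (subst Geq) auto
  have "g holomorphic_on A"
  proof -
    have "g holomorphic_on (A \<inter> ball w (cmod w))" if "w \<in> A" for w
    proof -
      have w0: "w \<noteq> 0" using that root0 by (auto simp: A_def annulus_def)
      \<comment> \<open>\<open>L\<close> is \<open>n\<close> times a branch of the logarithm that is holomorphic near \<open>w\<close>, even across the cut of \<open>Ln\<close>.\<close>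
      define L where "L z = of_nat n * (Ln (z / w) + Ln w)" for z
      have near: "z / w \<notin> \<real>\<^sub>\<le>\<^sub>0" "z \<noteq> 0" if "z \<in> ball w (cmod w)" for z
      proof -
        have "cmod (1 - z / w) < 1"
          using that w0 by (simp add: dist_norm norm_divide diff_divide_eq_iff field_simps)
        then have "Re (z / w) > 0"
          using abs_Re_le_cmod[of "1 - z / w"] by (simp del: Re_divide)
        then show "z / w \<notin> \<real>\<^sub>\<le>\<^sub>0" by (auto simp: complex_nonpos_Reals_iff simp del: Re_divide)
        then show "z \<noteq> 0" by auto
      qed
      have expL: "exp (L z / of_nat n) = z" if "z \<in> ball w (cmod w)" for z
        using near[OF that] w0 n by (simp add: L_def exp_add)
      have LS: "L z \<in> S" if "z \<in> A \<inter> ball w (cmod w)" for z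
        using expA[of "L z"] expL that by simp
      have "L holomorphic_on (A \<inter> ball w (cmod w))"
        unfolding L_def using near w0 by (intro holomorphic_intros) auto
      then have "G \<circ> L holomorphic_on (A \<inter> ball w (cmod w))"
        using G(1) by (rule holomorphic_on_compose_gen) (use LS in auto)
      then show ?thesis
      proof (rule holomorphic_transform)
        fix z assume z: "z \<in> A \<inter> ball w (cmod w)"
        then show "(G \<circ> L) z = g z" using g_exp[OF LS[OF z]] expL by simp
      qed
    qed
    then have "g holomorphic_on (\<Union>w\<in>A. A \<inter> ball w (cmod w))"
      by (rule holomorphic_on_UN_open) (use \<open>open A\<close> in auto)
    moreover have "w \<in> ball w (cmod w)" if "w \<in> A" for w
      using that root0 by (auto simp: A_def annulus_def)
    then have "(\<Union>w\<in>A. A \<inter> ball w (cmod w)) = A" by blast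
    ultimately show ?thesis by simp
  qed
  have "inj_on g A"
  proof (rule inj_onI)
    fix x y assume xy: "x \<in> A" "y \<in> A" "g x = g y"
    then have "exp (Ln x) = exp (Ln y)"
      using Geq[OF LnS LnS] n by (simp add: g_def)
    moreover have "x \<noteq> 0" "y \<noteq> 0" using xy root0 by (auto simp: A_def annulus_def)
    ultimately show "x = y" by simp
  qed
  have "g ` A = V"
  proof (intro equalityI subsetI)
    fix v assume "v \<in> g ` A"
    then show "v \<in> V" using LnS G(2) by (auto simp: g_def)
  next
    fix v assume "v \<in> V"
    then obtain s where "s \<in> S" "v = G s" using G(2) by blast
    then show "v \<in> g ` A" using g_exp expA by (metis imageI)
  qed
  obtain f where "f holomorphic_on g ` A" "\<And>w. w \<in> A \<Longrightarrow> f (g w) = w"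
    using holomorphic_has_inverse[OF \<open>g holomorphic_on A\<close> \<open>open A\<close> \<open>inj_on g A\<close>] by metis
  then show ?thesis
    unfolding conformally_equivalent_def A_def[symmetric]
    using \<open>g holomorphic_on A\<close> \<open>g ` A = V\<close> by (intro exI[of _ f] exI[of _ g]) auto
qed

section \<open>The ends of an annulus\<close>

lemma connected_subset_of_disjoint_open:
  fixes N :: "'i \<Rightarrow> 'a::topological_space set"
  assumes "connected S" and opn: "\<And>i. i \<in> I \<Longrightarrow> open (N i)"
    and disj: "\<And>i j. i \<in> I \<Longrightarrow> j \<in> I \<Longrightarrow> i \<noteq> j \<Longrightarrow> N i \<inter> N j = {}"
    and sub: "S \<subseteq> (\<Union>i\<in>I. N i)" and "I \<noteq> {}"
  shows "\<exists>i\<in>I. \<forall>j\<in>I. j \<noteq> i \<longrightarrow> S \<inter> N j = {}"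
proof (cases "S = {}")
  case True
  then show ?thesis using \<open>I \<noteq> {}\<close> by blast
next
  case False
  then obtain x i where x: "x \<in> S" "i \<in> I" "x \<in> N i" using sub by blast
  define M where "M = (\<Union>j\<in>I - {i}. N j)"
  have "N i \<inter> S = {} \<or> M \<inter> S = {}"
  proof (rule connectedD[OF \<open>connected S\<close>])
    show "open (N i)" using x opn by blast
    show "open M" using opn by (auto simp: M_def)
    show "N i \<inter> M \<inter> S = {}" using disj x by (fastforce simp: M_def)
    show "S \<subseteq> N i \<union> M" using sub by (auto simp: M_def)
  qed
  then show ?thesis using x unfolding M_def by blast
qed

lemma bounded_away_in_annulus:
  assumes "compact Q" "Q \<subseteq> annulus r" "r < 1"
  obtains s t where "r < s" "s \<le> t" "t < 1" "\<And>w. w \<in> Q \<Longrightarrow> s \<le> cmod w \<and> cmod w \<le> t"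
proof (cases "Q = {}")
  case True
  then show ?thesis using that[of "(r+1)/2" "(r+1)/2"] \<open>r < 1\<close> by auto
next
  case False
  obtain x where "x \<in> Q" "\<And>y. y \<in> Q \<Longrightarrow> cmod x \<le> cmod y"
    using continuous_attains_inf[OF \<open>compact Q\<close> False, of cmod] by (auto intro: continuous_intros)
  moreover obtain y where "y \<in> Q" "\<And>z. z \<in> Q \<Longrightarrow> cmod z \<le> cmod y"
    using continuous_attains_sup[OF \<open>compact Q\<close> False, of cmod] by (auto intro: continuous_intros)
  ultimately show ?thesis using that[of "cmod x" "cmod y"] assms(2) by (auto simp: annulus_def)
qed

text \<open>
  Choose disjoint neighbourhoods \<open>N\<^sub>i\<close> of the three pieces \<open>K\<^sub>i\<close> of the complement. What remains
  of \<open>V\<close> is compact, so under a homeomorphism to the annulus it stays away from both boundary circles.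
  The images in \<open>V\<close> of thin collars of the two circles are connected, and each of them meets only one
  of the \<open>N\<^sub>i\<close>. Some \<open>N\<^sub>i\<close> meets neither; apart from \<open>K\<^sub>i\<close> it
  is covered by a compact subset of \<open>V\<close>, which makes \<open>K\<^sub>i\<close> open as well as closed.
\<close>
lemma annulus_not_three_ended:
  fixes K :: "nat \<Rightarrow> complex set"
  assumes V: "V = - (\<Union>i<3. K i)" "bounded V"
    and closed: "\<And>i. i < 3 \<Longrightarrow> closed (K i)" and ne: "\<And>i. i < 3 \<Longrightarrow> K i \<noteq> {}"
    and disj: "\<And>i j. i < 3 \<Longrightarrow> j < 3 \<Longrightarrow> i \<noteq> j \<Longrightarrow> K i \<inter> K j = {}"
    and "r < 1"
  shows "\<not> V homeomorphic annulus r"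
proof
  assume "V homeomorphic annulus r"
  then obtain f g where hom: "homeomorphism V (annulus r) f g"
    by (auto simp: homeomorphic_def)
  obtain N0 M where NM: "open N0" "open M" "K 0 \<subseteq> N0" "K 1 \<union> K 2 \<subseteq> M" "N0 \<inter> M = {}"
    using separation_normal[of "K 0" "K 1 \<union> K 2"] closed[of 0] closed[of 1] closed[of 2]
      disj[of 0 1] disj[of 0 2] by (auto simp: Int_Un_distrib)
  obtain N1 N2 where N12: "open N1" "open N2" "K 1 \<subseteq> N1" "K 2 \<subseteq> N2" "N1 \<inter> N2 = {}"
    using separation_normal[of "K 1" "K 2"] closed[of 1] closed[of 2] disj[of 1 2] by auto
  \<comment> \<open>Intersecting with \<open>M\<close> keeps the neighbourhoods of \<open>K 1\<close> and \<open>K 2\<close> away from \<open>N0\<close>.\<close>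
  define N where "N i = (if i = 0 then N0 else if i = 1 then N1 \<inter> M else N2 \<inter> M)" for i :: nat
  have opnN: "open (N i)" for i
    using NM N12 by (auto simp: N_def)
  have less3: "i < 3 \<longleftrightarrow> i = 0 \<or> i = 1 \<or> i = 2" for i :: nat by auto
  have KN: "K i \<subseteq> N i" if "i < 3" for i
    using that NM N12 by (auto simp: N_def less3)
  have disjN: "N i \<inter> N j = {}" if "i < 3" "j < 3" "i \<noteq> j" for i j
    using that NM N12 unfolding less3 by (auto simp: N_def)
  define Q where "Q = - (\<Union>i<3. N i)"
  have QV: "Q \<subseteq> V" using KN V by (auto simp: Q_def)
  have "compact Q"
    using QV \<open>bounded V\<close> opnN by (auto simp: compact_eq_bounded_closed Q_def intro: bounded_subset)
  then have "compact (f ` Q)"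
    using hom QV by (meson compact_continuous_image continuous_on_subset homeomorphism_def)
  moreover have "f ` Q \<subseteq> annulus r"
    using hom QV by (auto simp: homeomorphism_def)
  ultimately obtain s t where st: "r < s" "s \<le> t" "t < 1" "\<And>w. w \<in> f ` Q \<Longrightarrow> s \<le> cmod w \<and> cmod w \<le> t"
    using bounded_away_in_annulus \<open>r < 1\<close> by metis
  have avoids: "\<exists>i\<in>{..<3}. \<forall>j\<in>{..<3}. j \<noteq> i \<longrightarrow> g ` E \<inter> N j = {}"
    if E: "connected E" "E \<subseteq> annulus r" "E \<inter> f ` Q = {}" for E
  proof (rule connected_subset_of_disjoint_open)
    show "connected (g ` E)"
      using hom E by (meson connected_continuous_image continuous_on_subset homeomorphism_def)
    have "w \<in> f ` Q" if "w \<in> E" "g w \<in> Q" for w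
      using that hom E by (metis homeomorphism_def image_eqI subsetD)
    then show "g ` E \<subseteq> (\<Union>i\<in>{..<3}. N i)"
      using E unfolding Q_def by blast
  qed (use opnN disjN in \<open>auto simp: lessThan_empty_iff\<close>)
  define E1 where "E1 = {w::complex. r < cmod w \<and> cmod w < s}"
  define E2 where "E2 = {w::complex. t < cmod w \<and> cmod w < 1}"
  have "connected E1" "connected E2"
    using connected_annulus[of r "0::complex" s] connected_annulus[of t "0::complex" 1]
    by (simp_all add: E1_def E2_def)
  moreover have "E1 \<subseteq> annulus r" "E2 \<subseteq> annulus r" "E1 \<inter> f ` Q = {}" "E2 \<inter> f ` Q = {}"
    using st by (force simp: E1_def E2_def annulus_def)+
  ultimately obtain i1 i2 where i12:
      "\<And>j. j < 3 \<Longrightarrow> j \<noteq> i1 \<Longrightarrow> g ` E1 \<inter> N j = {}" "\<And>j. j < 3 \<Longrightarrow> j \<noteq> i2 \<Longrightarrow> g ` E2 \<inter> N j = {}"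
    using avoids[of E1] avoids[of E2] by (metis lessThan_iff)
  have "\<exists>i<3. i \<noteq> i1 \<and> i \<noteq> i2" unfolding less3 by presburger
  then obtain i where i: "i < 3" "i \<noteq> i1" "i \<noteq> i2" by blast
  define A where "A = {w::complex. s \<le> cmod w \<and> cmod w \<le> t}"
  have "A = cball 0 t - ball 0 s" by (auto simp: A_def)
  then have "compact A" by (metis compact_cball compact_diff open_ball)
  moreover have Aann: "A \<subseteq> annulus r" using st by (auto simp: A_def annulus_def)
  ultimately have gA: "compact (g ` A)" "g ` A \<subseteq> V"
    using hom by (auto simp: homeomorphism_def intro: compact_continuous_image continuous_on_subset)
  have "N i \<inter> V \<subseteq> g ` A"
  proof
    fix z assume z: "z \<in> N i \<inter> V"
    then have "z = g (f z)" "f z \<in> annulus r" using hom by (auto simp: homeomorphism_def)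
    moreover have "f z \<notin> E1" "f z \<notin> E2" using i12 i z calculation by (metis IntD1 disjoint_iff image_eqI)+
    ultimately show "z \<in> g ` A"
      by (intro image_eqI[of z g "f z"]) (auto simp: A_def E1_def E2_def annulus_def)
  qed
  moreover have "N i - K i \<subseteq> V"
    unfolding V using KN disjN i by fastforce
  moreover have "K i \<inter> V = {}" using V i by auto
  ultimately have "K i = N i - g ` A"
    using KN[OF i(1)] gA by blast
  then have "open (K i)"
    using opnN gA(1) by (simp add: open_Diff compact_imp_closed)
  then have "K i = UNIV"
    using closed ne i clopen by blast
  moreover have "\<exists>j<3. j \<noteq> i" unfolding less3 by (metis zero_neq_one)
  ultimately show False using disj ne i by (metis inf_top_left)
qed

text \<open>
  If \<open>K\<close> split into two closed pieces, these and the exterior of the disk would be three pieces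
  of the complement of an annulus.
\<close>
lemma connected_hole_of_annulus:
  assumes K: "compact K" "K \<subseteq> unit_disk" and "r < 1"
    and hom: "(unit_disk - K) homeomorphic annulus r"
  shows "connected K"
proof (rule ccontr)
  assume "\<not> connected K"
  then obtain K1 K2 where K12: "closed K1" "closed K2" "K1 \<noteq> {}" "K2 \<noteq> {}" "K1 \<union> K2 = K" "K1 \<inter> K2 = {}"
    using connected_closed_set[OF compact_imp_closed[OF K(1)]] by auto
  define L where "L i = (if i = 0 then - unit_disk else if i = 1 then K1 else K2)" for i :: nat
  have less3: "i < 3 \<longleftrightarrow> i = 0 \<or> i = 1 \<or> i = 2" for i :: nat by auto
  have "- (unit_disk :: complex set) \<noteq> {}"
    by (metis Compl_empty_eq bounded_ball double_complement not_bounded_UNIV)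
  have "\<not> (unit_disk - K) homeomorphic annulus r"
  proof (rule annulus_not_three_ended[where K = L])
    show "unit_disk - K = - (\<Union>i<3. L i)"
      using K12 by (auto simp: L_def less3 split: if_splits)
    show "bounded (unit_disk - K)" by (simp add: bounded_diff)
    show "L i \<inter> L j = {}" if "i < 3" "j < 3" "i \<noteq> j" for i j
      using that K12 K(2) unfolding less3 by (auto simp: L_def)
    show "L i \<noteq> {}" for i using K12 \<open>- unit_disk \<noteq> {}\<close> by (simp add: L_def)
    show "closed (L i)" for i using K12 by (simp add: L_def closed_Compl)
  qed fact
  with hom show False by blast
qed

section \<open>Doubly connected domains in the disk\<close>

lemma connected_components_of_two_clopen:
  assumes "connectedin X P" "connectedin X Q" "closedin X P" "closedin X Q"
    and "P \<noteq> {}" "Q \<noteq> {}" "P \<inter> Q = {}" "P \<union> Q = topspace X"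
  shows "connected_components_of X = {P, Q}"
proof -
  have "topspace X - Q = P" "topspace X - P = Q" using assms by auto
  then have opn: "openin X P" "openin X Q"
    using assms openin_diff[OF openin_topspace] by metis+
  have comp: "A \<in> connected_components_of X"
    if A: "connectedin X A" "closedin X A" "openin X A" "A \<noteq> {}" for A
  proof -
    have "X \<noteq> trivial_topology" using A by (auto dest: closedin_subset)
    then obtain C where C: "C \<in> connected_components_of X" "A \<subseteq> C"
      using exists_connected_component_of_superset[OF A(1)] by metis
    then have "C \<subseteq> A \<or> disjnt C A"
      using A by (intro connectedin_clopen_cases) (auto intro: connectedin_connected_components_of)
    then have "C = A" using A(4) C(2) by (auto simp: disjnt_def)
    then show ?thesis using C by simp
  qed
  have PQ: "P \<in> connected_components_of X" "Q \<in> connected_components_of X"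
    using comp assms opn by blast+
  have "C = P \<or> C = Q" if C: "C \<in> connected_components_of X" for C
  proof -
    have "C \<noteq> {}" "C \<subseteq> P \<union> Q"
      using C assms(8) by (auto dest: nonempty_connected_components_of connected_components_of_subset)
    then show ?thesis
      using connected_components_of_overlap[OF C PQ(1)] connected_components_of_overlap[OF C PQ(2)]
      by blast
  qed
  then show ?thesis using PQ by blast
qed

text \<open>
  The two components are \<open>K\<close> and the exterior of the disk together with infinity. The latter is connected since
  infinity lies in the closure of the exterior.
\<close>
lemma doubly_connected_disk_minus_continuum:
  assumes K: "compact K" "connected K" "K \<noteq> {}" "K \<subseteq> unit_disk"
    and conn: "connected (unit_disk - K)"
  shows "doubly_connected (unit_disk - K)"
proof -
  define P where "P = insert None (Some ` (- (unit_disk :: complex set)))"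
  define Q where "Q = Some ` K"
  define Y where "Y = subtopology riemann_sphere (UNIV - Some ` (unit_disk - K))"
  have top: "UNIV - Some ` (unit_disk - K) = P \<union> Q"
  proof (rule set_eqI)
    fix x show "x \<in> UNIV - Some ` (unit_disk - K) \<longleftrightarrow> x \<in> P \<union> Q"
      using K(4) by (cases x) (auto simp: P_def Q_def)
  qed
  have topRS: "topspace riemann_sphere = UNIV"
    unfolding riemann_sphere_def by (auto simp: notin_range_Some)
  have imageSome: "connectedin riemann_sphere (Some ` A)" if "connected A" for A :: "complex set"
    using that connectedin_continuous_map_image[OF continuous_map_Some, of euclidean A]
    by (simp add: riemann_sphere_def)
  have closedP: "closedin riemann_sphere P"
  proof -
    have "P = topspace riemann_sphere - Some ` (unit_disk :: complex set)"
    proof (rule set_eqI)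
      fix x show "x \<in> P \<longleftrightarrow> x \<in> topspace riemann_sphere - Some ` unit_disk"
        unfolding topRS by (cases x) (auto simp: P_def)
    qed
    then show ?thesis
      unfolding riemann_sphere_def closedin_Alexandroff_compactification by auto
  qed
  have closedQ: "closedin riemann_sphere Q"
    unfolding riemann_sphere_def Q_def using K(1) by (simp add: compact_imp_closed)
  have "connectedin riemann_sphere P"
  proof (rule connectedin_intermediate_closure_of)
    show "connectedin riemann_sphere (Some ` (- (unit_disk :: complex set)))"
      by (intro imageSome connected_complement_bounded_convex) auto
    show "Some ` (- unit_disk) \<subseteq> P" by (auto simp: P_def)
    have "None \<in> riemann_sphere closure_of Some ` (- (unit_disk :: complex set))"
      unfolding in_closure_of
    proof (intro conjI allI impI)
      fix T assume T: "None \<in> T \<and> openin riemann_sphere T"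
      then obtain C :: "complex set" where C: "compact C" "T = insert None (Some ` (- C))"
        unfolding riemann_sphere_def openin_Alexandroff_compactification
        by (auto simp: Compl_eq_Diff_UNIV)
      have "bounded (C \<union> unit_disk)" using C(1) by (simp add: compact_imp_bounded)
      then obtain z where "z \<notin> C \<union> unit_disk" by (metis UNIV_eq_I not_bounded_UNIV)
      then show "\<exists>y. y \<in> Some ` (- (unit_disk :: complex set)) \<and> y \<in> T"
        using C(2) by (intro exI[of _ "Some z"]) auto
    qed (simp add: topRS)
    moreover have "Some ` (- unit_disk) \<subseteq> riemann_sphere closure_of Some ` (- (unit_disk :: complex set))"
      by (intro closure_of_subset) (simp add: topRS)
    ultimately show "P \<subseteq> riemann_sphere closure_of Some ` (- unit_disk)"
      unfolding P_def by blast
  qed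
  moreover have "connectedin riemann_sphere Q" unfolding Q_def using K(2) by (rule imageSome)
  ultimately have "connectedin Y P" "connectedin Y Q"
    unfolding Y_def top connectedin_subtopology by blast+
  moreover have "closedin Y P" "closedin Y Q"
    unfolding Y_def top using closedP closedQ by (simp_all add: closedin_subset_topspace)
  moreover have "P \<inter> Q = {}" "P \<noteq> {}" "Q \<noteq> {}" using K by (auto simp: P_def Q_def)
  moreover have "P \<union> Q = topspace Y" by (simp add: Y_def top topRS)
  ultimately have "connected_components_of Y = {P, Q}" "P \<noteq> Q"
    using connected_components_of_two_clopen[of Y P Q] by auto
  then have "card (connected_components_of Y) = 2" by simp
  moreover have "open (unit_disk - K)" using K(1) by (simp add: open_Diff compact_imp_closed)
  ultimately show ?thesis using conn unfolding doubly_connected_def Y_def by blast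
qed

lemma conformally_equivalent_imp_homeomorphic:
  assumes "conformally_equivalent U V"
  shows "U homeomorphic V"
proof -
  obtain f g where fg: "f holomorphic_on U" "g holomorphic_on V"
    "\<forall>z\<in>U. f z \<in> V \<and> g (f z) = z" "\<forall>w\<in>V. g w \<in> U \<and> f (g w) = w"
    using assms unfolding conformally_equivalent_def by blast
  have "homeomorphism U V f g"
    by (rule homeomorphismI) (use fg in \<open>auto intro: holomorphic_on_imp_continuous_on\<close>)
  then show ?thesis by (auto simp: homeomorphic_def)
qed

section \<open>Modulus of the preimage\<close>

theorem theorem6p2:
  fixes B :: "complex \<Rightarrow> complex" and a b :: complex and n :: nat
    and l :: "complex set" and lam :: real
  assumes "shabat_blaschke_product B a b n"
    and "poincare_geodesic_segment a b l"
    and "has_modulus (unit_disk - l) lam"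
  shows "has_modulus (unit_disk - {z \<in> unit_disk. B z \<in> l}) (lam / real n)"
proof -
  have B: "finite_blaschke_product B n" and a: "a \<in> unit_disk"
    and crit: "\<And>z. z \<in> unit_disk \<Longrightarrow> deriv B z = 0 \<Longrightarrow> B z \<in> {a, b}"
    using assms(1) unfolding shabat_blaschke_product_def by blast+
  have n: "n \<ge> 1" using B by (simp add: finite_blaschke_product_def)
  obtain \<gamma> where \<gamma>: "disk_path a b \<gamma>" "l = path_image \<gamma>"
    using assms(2) unfolding poincare_geodesic_segment_def by blast
  have l: "compact l" "l \<subseteq> unit_disk" "{a, b} \<subseteq> l"
    using \<gamma> pathstart_in_path_image[of \<gamma>] pathfinish_in_path_image[of \<gamma>] unfolding disk_path_def
    by (auto simp: valid_path_imp_path compact_path_image)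
  obtain r where U: "doubly_connected (unit_disk - l)" and r: "0 < r" "r < 1"
    and equiv: "conformally_equivalent (unit_disk - l) (annulus r)"
    and lam: "lam = 1 / (2 * pi) * ln (1 / r)"
    using assms(3) unfolding has_modulus_def by blast
  have pcU: "path_connected (unit_disk - l)"
    using U by (simp add: doubly_connected_def connected_open_path_connected)
  define K where "K = {z \<in> unit_disk. B z \<in> l}"
  define V where "V = unit_disk - K"
  have compK: "compact K" unfolding K_def by (rule finite_blaschke_proper[OF B l(1,2)])
  have openV: "open V" unfolding V_def using compK by (simp add: open_Diff compact_imp_closed)
  have hol: "B holomorphic_on unit_disk" by (rule finite_blaschke_holomorphic[OF B])
  then have holV: "B holomorphic_on V" by (rule holomorphic_on_subset) (simp add: V_def)
  have mapsB: "B ` unit_disk \<subseteq> unit_disk" using finite_blaschke_maps_disk[OF B] by blast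
  have regular: "deriv B z \<noteq> 0" if "z \<in> unit_disk" "B z \<notin> l" for z
    using crit[OF that(1)] that(2) l(3) by blast
  have fibre: "card {z \<in> V. B z = u} = n" if u: "u \<in> unit_disk - l" for u
  proof -
    have "{z \<in> V. B z = u} = {z \<in> unit_disk. B z = u}" using u by (auto simp: V_def K_def)
    also have "card \<dots> = n"
      using u regular by (intro finite_blaschke_fibre_card[OF B]) auto
    finally show ?thesis .
  qed
  have cov: "covering_space V B (unit_disk - l)"
  proof (rule covering_space_constant_fibre_card[OF openV holV])
    show "B ` V \<subseteq> unit_disk - l" using mapsB unfolding V_def K_def by blast
    show "deriv B z \<noteq> 0" if "z \<in> V" for z using that regular by (simp add: V_def K_def)
  qed (use fibre n in auto)
  have pcV: "path_connected V"
    unfolding V_def K_def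
    by (rule path_connected_vimage_by_boundary_collar[OF holomorphic_on_imp_continuous_on[OF hol] mapsB
          l(1,2) compK[unfolded K_def] cov[unfolded V_def K_def] pcU])
  have equivV: "conformally_equivalent V (annulus (root n r))"
    by (rule finite_cover_of_annulus_conformally_equivalent[OF r openV pcV holV cov fibre n equiv])
  have r': "0 < root n r" "root n r < 1" using r n by auto
  have "connected K"
    by (rule connected_hole_of_annulus[OF compK _ r'(2)
          conformally_equivalent_imp_homeomorphic[OF equivV[unfolded V_def]]]) (auto simp: K_def)
  moreover have "K \<noteq> {}"
  proof
    assume "K = {}"
    then have "{z \<in> unit_disk. B z = a} = {}" using l(3) by (auto simp: K_def)
    \<comment> \<open>The condition on critical points holds vacuously for an empty fibre.\<close>
    moreover from this have "card {z \<in> unit_disk. B z = a} = n"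
      using a by (intro finite_blaschke_fibre_card[OF B]) auto
    ultimately show False using n by (metis card.empty not_one_le_zero)
  qed
  ultimately have "doubly_connected V"
    unfolding V_def using compK pcV
    by (intro doubly_connected_disk_minus_continuum) (auto simp: K_def V_def path_connected_imp_connected)
  moreover have "lam / real n = 1 / (2 * pi) * ln (1 / root n r)"
    using r n by (simp add: lam ln_div ln_root)
  ultimately show ?thesis
    unfolding has_modulus_def V_def[symmetric] K_def[symmetric] using equivV r' by blast
qed

end
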